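(* Let $\pi\colon(\Gamma,\alpha)\to(B,\alpha_B)$ be a GKM fiber bundle, where $\Gamma=(V,E)$, $B=(V_B,E_B)$, and both axial functions take values in the same finite-dimensional real vector space $\mathfrak{t}^*$. Let $c_1,\dots,c_m\in H_\alpha^*(\Gamma)$ be cohomology classes on $\Gamma$ such that, for every vertex $p$ of $B$, the restrictions of $c_1,\dots,c_m$ to the fiber $\Gamma_p=\pi^{-1}(p)$ form a basis of the $\mathbb{S}(\mathfrak{t}^* )$-module $H_\alpha^*(\Gamma_p)$. Then, as $H_{\alpha_B}^*(B)$-modules, $H_\alpha^*(\Gamma)$ is isomorphic to the free $H_{\alpha_B}^*(B)$-module on $c_1,\dots,c_m$; that is, every $c\in H_\alpha^*(\Gamma)$ can be written uniquely as $c=\sum_{k=1}^m \pi^*(\beta_k)\,c_k$ with $\beta_k\in H_{\alpha_B}^*(B)$, where $\pi^*(\beta)(q)=\beta(\pi(q))$.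
   Context: Graphs: a graph $\Gamma=(V,E)$ is regular, and $E$ is the set of oriented edges (each unoriented edge joining $p,q$ appears as both $(p,q)$ and $(q,p)$); $E_p$ denotes the oriented edges with initial vertex $p$. A connection on $\Gamma$ is a family of bijections $\nabla_{(p,q)}\colon E_p\to E_q$, one for each oriented edge, with $\nabla_{(p,q)}(p,q)=(q,p)$ and $\nabla_{(q,p)}=\nabla_{(p,q)}^{-1}$. An axial function compatible with $\nabla$ is a map $\alpha\colon E\to\mathfrak{t}^*$ ($\mathfrak{t}^*$ a finite-dimensional real vector space) with $\alpha(q,p)=-\alpha(p,q)$, the vectors $\{\alpha(e):e\in E_p\}$ pairwise linearly independent for each $p$, and $\alpha(\nabla_e(e'))-\alpha(e')\in\mathbb{R}\,\alpha(e)$ for all $e=(p,q)$, $e'\in E_p$. A GKM graph is a regular graph with an axial function (compatible with some connection). Cohomology: $\mathbb{S}(\mathfrak{t}^* )$ is the symmetric algebra (polynomial ring) on $\mathfrak{t}^*$. For a GKM graph $(\Gamma,\alpha)$, $H_\alpha^*(\Gamma)$ is the ring of maps $f\colon V\to\mathbb{S}(\mathfrak{t}^* )$ with $f(q)-f(p)\in\alpha(p,q)\,\mathbb{S}(\mathfrak{t}^* )$ for every edge $(p,q)$; it is an $\mathbb{S}(\mathfrak{t}^* )$-module. For a subgraph, the same definition is used with its own edges and the restricted $\alpha$. Fibrations: a morphism of graphs $\pi\colon\Gamma\to B$ is a map on vertices such that for each edge $(p,q)$ of $\Gamma$ either $\pi(p)=\pi(q)$ (the edge is vertical) or $(\pi(p),\pi(q))$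 is an edge of $B$ (horizontal). $\pi$ is a fibration if for each vertex $q$ the map $(q,q')\mapsto(\pi(q),\pi(q'))$ from horizontal edges at $q$ to $E_{B,\pi(q)}$ is bijective; then each edge $(p,q)$ of $B$ has a unique lift at each $p'\in\pi^{-1}(p)$. For $p\in V_B$ let $\Gamma_p$ be the induced subgraph on $\pi^{-1}(p)$, and for an edge $(p,q)$ of $B$ let $\Phi_{p,q}\colon\pi^{-1}(p)\to\pi^{-1}(q)$ send $p'$ to the endpoint of the lift of $(p,q)$ at $p'$. $\pi$ is a fiber bundle (of graphs) if all $\Phi_{p,q}$ are graph morphisms $\Gamma_p\to\Gamma_q$. GKM fibration: given GKM graphs $(\Gamma,\alpha)$, $(B,\alpha_B)$ with connections $\nabla,\nabla_B$ compatible with $\alpha,\alpha_B$, $\pi$ is a GKM fibration if (1) $\pi$ is a fibration; (2) $\alpha(\tilde e)=\alpha_B(e)$ for every edge $e$ of $B$ and every lift $\tilde e$; (3) $\nabla$ along any edge maps horizontal edges to horizontal edges and vertical to vertical; (4) if $e=(p,q)$ is an edge of $B$ with lift $\tilde e$ at $p'$, $e'\in E_{B,p}$, $e''=(\nabla_B)_e(e')$, then $\nabla_{\tilde e}$ maps the lift of $e'$ at $p'$ to the lift of $e''$ at the endpoint of $\tilde e$. (Some choice of compatible connections is allowed.) Each fiber $\Gamma_p$ with restricted $\alpha$ is then a GKM graph; let $\mathfrak{v}_p^*$ be the span of $\alpha$ on edges of $\Gamma_p$. GKM fiber bundle: a GKM fibration that is a fiber bundle such that for every edge $(p,q)$ of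 $B$: (i) for every lift $(p_1,q_1)$ of $(p,q)$ and every edge $(p_1,p_2)$ of $\Gamma_p$, the connection along $(p_1,q_1)$ sends $(p_1,p_2)$ to $(\Phi_{p,q}(p_1),\Phi_{p,q}(p_2))$; (ii) there is a linear isomorphism $\Psi_{p,q}\colon\mathfrak{v}_p^*\to\mathfrak{v}_q^*$ with $\alpha(\Phi_{p,q}(a),\Phi_{p,q}(b))=\Psi_{p,q}(\alpha(a,b))$ for every edge $(a,b)$ of $\Gamma_p$. *)

theory Defs
  imports
    "HOL-Library.Poly_Mapping"
    "HOL-Algebra.Module"
    "HOL-Algebra.Algebraic_Closure_Type"
    "Graph_Theory.Pair_Digraph"
begin

section \<open>The symmetric algebra of a real vector space\<close>

text \<open>
  The free commutative real algebra on the underlying set of a vector space has type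
  \<open>('v \<Rightarrow>\<^sub>0 nat) \<Rightarrow>\<^sub>0 real\<close> (monomials are finitely supported exponent functions). The symmetric
  algebra is its quotient by the ideal that makes the inclusion of generators linear.
\<close>

definition free_var :: "'v \<Rightarrow> ('v \<Rightarrow>\<^sub>0 nat) \<Rightarrow>\<^sub>0 real" where
  "free_var v = Poly_Mapping.single (Poly_Mapping.single v 1) 1"

definition free_const :: "real \<Rightarrow> ('v \<Rightarrow>\<^sub>0 nat) \<Rightarrow>\<^sub>0 real" where
  "free_const r = Poly_Mapping.single 0 r"

inductive_set sym_ideal :: "(('v::real_vector \<Rightarrow>\<^sub>0 nat) \<Rightarrow>\<^sub>0 real) set" where
  zero: "0 \<in> sym_ideal"
| add: "f \<in> sym_ideal \<Longrightarrow> g \<in> sym_ideal \<Longrightarrow> f + g \<in> sym_ideal"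
| mult: "g \<in> sym_ideal \<Longrightarrow> f * g \<in> sym_ideal"
| gen_add: "free_var (v + w) - (free_var v + free_var w) \<in> sym_ideal"
| gen_scale: "free_var (r *\<^sub>R v) - free_const r * free_var v \<in> sym_ideal"

lemma sym_ideal_uminus: "f \<in> sym_ideal \<Longrightarrow> - f \<in> sym_ideal"
  using sym_ideal.mult[of f "-1"] by simp

lemma sym_ideal_diff: "f \<in> sym_ideal \<Longrightarrow> g \<in> sym_ideal \<Longrightarrow> f - g \<in> sym_ideal"
  using sym_ideal.add[OF _ sym_ideal_uminus, of f g] by simp

lemma lookup_free_var_0 [simp]: "Poly_Mapping.lookup (free_var v) 0 = 0"
proof -
  have "Poly_Mapping.single v (1::nat) \<noteq> 0"
    by (metis lookup_single_eq lookup_zero zero_neq_one)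
  then show ?thesis by (simp add: free_var_def lookup_single when_def)
qed

lemma lookup_mult_0:
  fixes f g :: "('v \<Rightarrow>\<^sub>0 nat) \<Rightarrow>\<^sub>0 real"
  assumes "Poly_Mapping.lookup g 0 = 0"
  shows "Poly_Mapping.lookup (f * g) 0 = 0"
proof (rule ccontr)
  assume "Poly_Mapping.lookup (f * g) 0 \<noteq> 0"
  then have "0 \<in> Poly_Mapping.keys (f * g)" by (simp add: in_keys_iff)
  then obtain a b where ab: "0 = a + b" "b \<in> Poly_Mapping.keys g"
    using keys_mult[of f g] by auto
  have "Poly_Mapping.lookup a i + Poly_Mapping.lookup b i = 0" for i
    using ab(1) by (metis lookup_add lookup_zero)
  then have "b = 0" by (intro poly_mapping_eqI) simp
  with ab(2) assms show False by (simp add: in_keys_iff)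
qed

lemma lookup_sym_ideal_0: "f \<in> sym_ideal \<Longrightarrow> Poly_Mapping.lookup f 0 = 0"
  by (induction rule: sym_ideal.induct) (simp_all add: lookup_add lookup_minus lookup_mult_0)

definition sym_rel ::
  "(('v::real_vector \<Rightarrow>\<^sub>0 nat) \<Rightarrow>\<^sub>0 real) \<Rightarrow> (('v \<Rightarrow>\<^sub>0 nat) \<Rightarrow>\<^sub>0 real) \<Rightarrow> bool" where
  "sym_rel f g \<longleftrightarrow> f - g \<in> sym_ideal"

lemma equivp_sym_rel: "equivp sym_rel"
proof (rule equivpI)
  show "reflp sym_rel" by (simp add: reflp_def sym_rel_def sym_ideal.zero)
  show "symp sym_rel"
    by (intro sympI) (metis minus_diff_eq sym_ideal_uminus sym_rel_def)
  show "transp sym_rel"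
  proof (intro transpI)
    fix f g h assume "sym_rel f g" "sym_rel g h"
    then have "(f - g) + (g - h) \<in> sym_ideal" unfolding sym_rel_def by (rule sym_ideal.add)
    then show "sym_rel f h" by (simp add: sym_rel_def)
  qed
qed

quotient_type (overloaded) 'v sym_alg = "('v::real_vector \<Rightarrow>\<^sub>0 nat) \<Rightarrow>\<^sub>0 real" / sym_rel
  by (rule equivp_sym_rel)

instantiation sym_alg :: (real_vector) comm_ring_1
begin

lift_definition zero_sym_alg :: "'a sym_alg" is 0 .
lift_definition one_sym_alg :: "'a sym_alg" is 1 .

lift_definition plus_sym_alg :: "'a sym_alg \<Rightarrow> 'a sym_alg \<Rightarrow> 'a sym_alg" is "(+)"
  unfolding sym_rel_def by (simp only: add_diff_add sym_ideal.add)

lift_definition uminus_sym_alg :: "'a sym_alg \<Rightarrow> 'a sym_alg" is uminus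
  unfolding sym_rel_def by (simp only: minus_diff_minus sym_ideal_uminus)

lift_definition minus_sym_alg :: "'a sym_alg \<Rightarrow> 'a sym_alg \<Rightarrow> 'a sym_alg" is "(-)"
proof -
  fix f f' g g' :: "('a \<Rightarrow>\<^sub>0 nat) \<Rightarrow>\<^sub>0 real"
  assume "sym_rel f f'" "sym_rel g g'"
  then have "(f - f') - (g - g') \<in> sym_ideal" unfolding sym_rel_def by (rule sym_ideal_diff)
  then show "sym_rel (f - g) (f' - g')" by (simp add: sym_rel_def algebra_simps)
qed

lift_definition times_sym_alg :: "'a sym_alg \<Rightarrow> 'a sym_alg \<Rightarrow> 'a sym_alg" is "(*)"
proof -
  fix f f' g g' :: "('a \<Rightarrow>\<^sub>0 nat) \<Rightarrow>\<^sub>0 real"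
  assume "sym_rel f f'" "sym_rel g g'"
  then have "g * (f - f') + f' * (g - g') \<in> sym_ideal"
    unfolding sym_rel_def by (intro sym_ideal.add sym_ideal.mult)
  then show "sym_rel (f * g) (f' * g')"
    by (simp add: sym_rel_def algebra_simps)
qed

instance
proof
  show "(0 :: 'a sym_alg) \<noteq> 1"
  proof (transfer, unfold sym_rel_def, rule notI)
    assume "(0 :: ('a \<Rightarrow>\<^sub>0 nat) \<Rightarrow>\<^sub>0 real) - 1 \<in> sym_ideal"
    from lookup_sym_ideal_0[OF this] show False by (simp add: lookup_minus lookup_one)
  qed
qed (transfer; simp add: sym_rel_def algebra_simps sym_ideal.zero)+

end

lift_definition sym_of :: "'v::real_vector \<Rightarrow> 'v sym_alg" is free_var .

lift_definition sym_const :: "real \<Rightarrow> 'v::real_vector sym_alg" is free_const .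

lemma sym_of_add: "sym_of (v + w) = sym_of v + sym_of w"
  by transfer (simp only: sym_rel_def sym_ideal.gen_add)

lemma sym_of_scaleR: "sym_of (r *\<^sub>R v) = sym_const r * sym_of v"
  by transfer (simp only: sym_rel_def sym_ideal.gen_scale)


section \<open>GKM graphs\<close>

text \<open>
  The library predicate \<^const>\<open>pair_bidirected_digraph\<close> describes a symmetric, loop-free set of
  oriented edges, with no finiteness requirement on the set of vertices.
\<close>

definition regular_graph :: "'v pair_pre_digraph \<Rightarrow> bool" where
  "regular_graph G \<longleftrightarrow> pair_bidirected_digraph G \<and>
     (\<exists>d. \<forall>p\<in>pverts G. finite (out_arcs G p) \<and> out_degree G p = d)"

definition is_connection ::
  "'v pair_pre_digraph \<Rightarrow> ('v \<times> 'v \<Rightarrow> 'v \<times> 'v \<Rightarrow> 'v \<times> 'v) \<Rightarrow> bool" where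
  "is_connection G nabla \<longleftrightarrow> (\<forall>(p,q)\<in>parcs G.
     bij_betw (nabla (p,q)) (out_arcs G p) (out_arcs G q) \<and>
     nabla (p,q) (p,q) = (q,p) \<and>
     (\<forall>e\<in>out_arcs G p. nabla (q,p) (nabla (p,q) e) = e))"

definition is_axial_function ::
  "'v pair_pre_digraph \<Rightarrow> ('v \<times> 'v \<Rightarrow> 'v \<times> 'v \<Rightarrow> 'v \<times> 'v) \<Rightarrow> ('v \<times> 'v \<Rightarrow> 't::real_vector) \<Rightarrow> bool" where
  "is_axial_function G nabla \<alpha> \<longleftrightarrow>
     (\<forall>(p,q)\<in>parcs G. \<alpha> (q,p) = - \<alpha> (p,q)) \<and>
     (\<forall>p\<in>pverts G. \<forall>e\<in>out_arcs G p. \<forall>e'\<in>out_arcs G p. e \<noteq> e' \<longrightarrow>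
        \<alpha> e \<noteq> \<alpha> e' \<and> independent {\<alpha> e, \<alpha> e'}) \<and>
     (\<forall>(p,q)\<in>parcs G. \<forall>e'\<in>out_arcs G p.
        \<exists>r. \<alpha> (nabla (p,q) e') - \<alpha> e' = r *\<^sub>R \<alpha> (p,q))"

definition gkm_graph :: "'v pair_pre_digraph \<Rightarrow> ('v \<times> 'v \<Rightarrow> 't::real_vector) \<Rightarrow> bool" where
  "gkm_graph G \<alpha> \<longleftrightarrow> regular_graph G \<and>
     (\<exists>nabla. is_connection G nabla \<and> is_axial_function G nabla \<alpha>)"


section \<open>Fibrations and fiber bundles of graphs\<close>

definition graph_morphism ::
  "'v pair_pre_digraph \<Rightarrow> 'w pair_pre_digraph \<Rightarrow> ('v \<Rightarrow> 'w) \<Rightarrow> bool" where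
  "graph_morphism G H \<phi> \<longleftrightarrow> (\<forall>p\<in>pverts G. \<phi> p \<in> pverts H) \<and>
     (\<forall>(p,q)\<in>parcs G. \<phi> p = \<phi> q \<or> (\<phi> p, \<phi> q) \<in> parcs H)"

definition vertical :: "('v \<Rightarrow> 'w) \<Rightarrow> 'v \<times> 'v \<Rightarrow> bool" where
  "vertical \<pi> e \<longleftrightarrow> \<pi> (fst e) = \<pi> (snd e)"

definition graph_fibration ::
  "'v pair_pre_digraph \<Rightarrow> 'w pair_pre_digraph \<Rightarrow> ('v \<Rightarrow> 'w) \<Rightarrow> bool" where
  "graph_fibration G B \<pi> \<longleftrightarrow> graph_morphism G B \<pi> \<and>
     (\<forall>q\<in>pverts G. bij_betw (map_prod \<pi> \<pi>)
        {e \<in> out_arcs G q. \<not> vertical \<pi> e} (out_arcs B (\<pi> q)))"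

definition lifts :: "'v pair_pre_digraph \<Rightarrow> ('v \<Rightarrow> 'w) \<Rightarrow> 'w \<times> 'w \<Rightarrow> ('v \<times> 'v) set" where
  "lifts G \<pi> e = {e' \<in> parcs G. map_prod \<pi> \<pi> e' = e}"

definition fiber :: "'v pair_pre_digraph \<Rightarrow> ('v \<Rightarrow> 'w) \<Rightarrow> 'w \<Rightarrow> 'v pair_pre_digraph" where
  "fiber G \<pi> p =
     \<lparr> pverts = {v \<in> pverts G. \<pi> v = p}, parcs = {(u,v) \<in> parcs G. \<pi> u = p \<and> \<pi> v = p} \<rparr>"

text \<open>The map \<open>\<Phi>\<^bsub>p,q\<^esub>\<close>: the endpoint of the lift of \<open>(p,q)\<close> at \<open>p'\<close>.\<close>

definition transport :: "'v pair_pre_digraph \<Rightarrow> ('v \<Rightarrow> 'w) \<Rightarrow> 'w \<Rightarrow> 'w \<Rightarrow> 'v \<Rightarrow> 'v" where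
  "transport G \<pi> p q p' = (THE q'. (p',q') \<in> lifts G \<pi> (p,q))"

definition graph_fiber_bundle ::
  "'v pair_pre_digraph \<Rightarrow> 'w pair_pre_digraph \<Rightarrow> ('v \<Rightarrow> 'w) \<Rightarrow> bool" where
  "graph_fiber_bundle G B \<pi> \<longleftrightarrow> graph_fibration G B \<pi> \<and>
     (\<forall>(p,q)\<in>parcs B. graph_morphism (fiber G \<pi> p) (fiber G \<pi> q) (transport G \<pi> p q))"


section \<open>GKM fibrations and GKM fiber bundles\<close>

definition gkm_fibration ::
  "'v pair_pre_digraph \<Rightarrow> ('v \<times> 'v \<Rightarrow> 't::real_vector) \<Rightarrow> ('v \<times> 'v \<Rightarrow> 'v \<times> 'v \<Rightarrow> 'v \<times> 'v) \<Rightarrow>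
   'w pair_pre_digraph \<Rightarrow> ('w \<times> 'w \<Rightarrow> 't) \<Rightarrow> ('w \<times> 'w \<Rightarrow> 'w \<times> 'w \<Rightarrow> 'w \<times> 'w) \<Rightarrow>
   ('v \<Rightarrow> 'w) \<Rightarrow> bool" where
  "gkm_fibration G \<alpha> nabla B \<alpha>B nablaB \<pi> \<longleftrightarrow>
     gkm_graph G \<alpha> \<and> gkm_graph B \<alpha>B \<and>
     is_connection G nabla \<and> is_axial_function G nabla \<alpha> \<and>
     is_connection B nablaB \<and> is_axial_function B nablaB \<alpha>B \<and>
     graph_fibration G B \<pi> \<and>
     (\<forall>e\<in>parcs B. \<forall>e'\<in>lifts G \<pi> e. \<alpha> e' = \<alpha>B e) \<and>
     (\<forall>(p,q)\<in>parcs G. \<forall>e\<in>out_arcs G p.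
        (vertical \<pi> e \<longrightarrow> vertical \<pi> (nabla (p,q) e)) \<and>
        (\<not> vertical \<pi> e \<longrightarrow> \<not> vertical \<pi> (nabla (p,q) e))) \<and>
     (\<forall>(p,q)\<in>parcs B. \<forall>(p',q')\<in>lifts G \<pi> (p,q). \<forall>e\<in>out_arcs B p. \<forall>e'\<in>out_arcs G p'.
        e' \<in> lifts G \<pi> e \<longrightarrow>
        nabla (p',q') e' \<in> out_arcs G q' \<and> nabla (p',q') e' \<in> lifts G \<pi> (nablaB (p,q) e))"

text \<open>The span \<open>\<vv>\<^sub>p\<^sup>*\<close> of the axial function on the edges of the fiber over \<open>p\<close>.\<close>

definition fiber_span ::
  "'v pair_pre_digraph \<Rightarrow> ('v \<times> 'v \<Rightarrow> 't::real_vector) \<Rightarrow> ('v \<Rightarrow> 'w) \<Rightarrow> 'w \<Rightarrow> 't set" where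
  "fiber_span G \<alpha> \<pi> p = span (\<alpha> ` parcs (fiber G \<pi> p))"

definition linear_iso_on :: "'t::real_vector set \<Rightarrow> 't set \<Rightarrow> ('t \<Rightarrow> 't) \<Rightarrow> bool" where
  "linear_iso_on U W \<psi> \<longleftrightarrow> bij_betw \<psi> U W \<and>
     (\<forall>x\<in>U. \<forall>y\<in>U. \<psi> (x + y) = \<psi> x + \<psi> y) \<and> (\<forall>r. \<forall>x\<in>U. \<psi> (r *\<^sub>R x) = r *\<^sub>R \<psi> x)"

definition gkm_fiber_bundle ::
  "'v pair_pre_digraph \<Rightarrow> ('v \<times> 'v \<Rightarrow> 't::real_vector) \<Rightarrow>
   'w pair_pre_digraph \<Rightarrow> ('w \<times> 'w \<Rightarrow> 't) \<Rightarrow> ('v \<Rightarrow> 'w) \<Rightarrow> bool" where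
  "gkm_fiber_bundle G \<alpha> B \<alpha>B \<pi> \<longleftrightarrow>
     (\<exists>nabla nablaB. gkm_fibration G \<alpha> nabla B \<alpha>B nablaB \<pi> \<and> graph_fiber_bundle G B \<pi> \<and>
       (\<forall>(p,q)\<in>parcs B.
          (\<forall>(p1,q1)\<in>lifts G \<pi> (p,q). \<forall>p2. (p1,p2) \<in> parcs (fiber G \<pi> p) \<longrightarrow>
             nabla (p1,q1) (p1,p2) = (transport G \<pi> p q p1, transport G \<pi> p q p2)) \<and>
          (\<exists>\<psi>. linear_iso_on (fiber_span G \<alpha> \<pi> p) (fiber_span G \<alpha> \<pi> q) \<psi> \<and>
             (\<forall>(a,b)\<in>parcs (fiber G \<pi> p).
                \<alpha> (transport G \<pi> p q a, transport G \<pi> p q b) = \<psi> (\<alpha> (a,b))))))"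


section \<open>Bases, free modules and isomorphisms of modules\<close>

text \<open>The family \<open>c\<^sub>1, \<dots>, c\<^sub>m\<close> is a basis of the \<open>R\<close>-module \<open>M\<close>.\<close>

definition module_basis ::
  "('a, 'm) ring_scheme \<Rightarrow> ('a, 'b, 'n) module_scheme \<Rightarrow> nat \<Rightarrow> (nat \<Rightarrow> 'b) \<Rightarrow> bool" where
  "module_basis R M m c \<longleftrightarrow> (\<forall>k\<in>{1..m}. c k \<in> carrier M) \<and>
     (\<forall>x\<in>carrier M. \<exists>a\<in>Pi {1..m} (\<lambda>_. carrier R). x = (\<Oplus>\<^bsub>M\<^esub>k\<in>{1..m}. a k \<odot>\<^bsub>M\<^esub> c k)) \<and>
     (\<forall>a\<in>Pi {1..m} (\<lambda>_. carrier R).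
        (\<Oplus>\<^bsub>M\<^esub>k\<in>{1..m}. a k \<odot>\<^bsub>M\<^esub> c k) = \<zero>\<^bsub>M\<^esub> \<longrightarrow> (\<forall>k\<in>{1..m}. a k = \<zero>\<^bsub>R\<^esub>))"

text \<open>The free module \<open>R\<^sup>m\<close>; the record type of modules also demands a multiplication and a unit.\<close>

definition free_module :: "('a, 'm) ring_scheme \<Rightarrow> nat \<Rightarrow> ('a, nat \<Rightarrow> 'a) module" where
  "free_module R m =
     \<lparr> carrier = {1..m} \<rightarrow>\<^sub>E carrier R,
       monoid.mult = (\<lambda>x y. \<lambda>k\<in>{1..m}. x k \<otimes>\<^bsub>R\<^esub> y k),
       monoid.one = (\<lambda>k\<in>{1..m}. \<one>\<^bsub>R\<^esub>),
       ring.zero = (\<lambda>k\<in>{1..m}. \<zero>\<^bsub>R\<^esub>),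
       ring.add = (\<lambda>x y. \<lambda>k\<in>{1..m}. x k \<oplus>\<^bsub>R\<^esub> y k),
       module.smult = (\<lambda>r x. \<lambda>k\<in>{1..m}. r \<otimes>\<^bsub>R\<^esub> x k) \<rparr>"

definition module_iso ::
  "('a, 'm) ring_scheme \<Rightarrow> ('a, 'b, 'n) module_scheme \<Rightarrow> ('a, 'c, 'o) module_scheme \<Rightarrow>
   ('b \<Rightarrow> 'c) set" where
  "module_iso R M N = {h. bij_betw h (carrier M) (carrier N) \<and>
     (\<forall>x\<in>carrier M. \<forall>y\<in>carrier M. h (x \<oplus>\<^bsub>M\<^esub> y) = h x \<oplus>\<^bsub>N\<^esub> h y) \<and>
     (\<forall>r\<in>carrier R. \<forall>x\<in>carrier M. h (r \<odot>\<^bsub>M\<^esub> x) = r \<odot>\<^bsub>N\<^esub> h x)}"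


section \<open>Graph cohomology\<close>

text \<open>
  Maps on the vertex set are represented by extensional functions, so that equality of
  elements is equality on the vertices. The record carries both the ring structure and the
  structure of a module over the symmetric algebra.
\<close>

definition cohomology ::
  "'v pair_pre_digraph \<Rightarrow> ('v \<times> 'v \<Rightarrow> 't::real_vector) \<Rightarrow> ('t sym_alg, 'v \<Rightarrow> 't sym_alg) module" where
  "cohomology G \<alpha> =
     \<lparr> carrier = {f \<in> pverts G \<rightarrow>\<^sub>E UNIV. \<forall>(p,q)\<in>parcs G. sym_of (\<alpha> (p,q)) dvd f q - f p},
       monoid.mult = (\<lambda>f g. \<lambda>p\<in>pverts G. f p * g p),
       monoid.one = (\<lambda>p\<in>pverts G. 1),
       ring.zero = (\<lambda>p\<in>pverts G. 0),
       ring.add = (\<lambda>f g. \<lambda>p\<in>pverts G. f p + g p),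
       module.smult = (\<lambda>s f. \<lambda>p\<in>pverts G. s * f p) \<rparr>"

definition pullback ::
  "'v pair_pre_digraph \<Rightarrow> ('v \<Rightarrow> 'w) \<Rightarrow> ('w \<Rightarrow> 's) \<Rightarrow> 'v \<Rightarrow> 's" where
  "pullback G \<pi> \<beta> = (\<lambda>q\<in>pverts G. \<beta> (\<pi> q))"

text \<open>The cohomology of the total space as a module over the cohomology of the base.\<close>

definition cohomology_over_base ::
  "'v pair_pre_digraph \<Rightarrow> ('v \<times> 'v \<Rightarrow> 't::real_vector) \<Rightarrow> ('v \<Rightarrow> 'w) \<Rightarrow>
   ('w \<Rightarrow> 't sym_alg, 'v \<Rightarrow> 't sym_alg) module" where
  "cohomology_over_base G \<alpha> \<pi> =
     \<lparr> carrier = carrier (cohomology G \<alpha>),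
       monoid.mult = monoid.mult (cohomology G \<alpha>),
       monoid.one = monoid.one (cohomology G \<alpha>),
       ring.zero = ring.zero (cohomology G \<alpha>),
       ring.add = ring.add (cohomology G \<alpha>),
       module.smult = (\<lambda>\<beta> f. pullback G \<pi> \<beta> \<otimes>\<^bsub>cohomology G \<alpha>\<^esub> f) \<rparr>"

lemma cohomology_carrierI:
  assumes "f \<in> extensional (pverts G)"
    and "\<And>p q. (p,q) \<in> parcs G \<Longrightarrow> sym_of (\<alpha> (p,q)) dvd f q - f p"
  shows "f \<in> carrier (cohomology G \<alpha>)"
  using assms by (auto simp: cohomology_def PiE_def)

lemma cohomology_carrierD:
  assumes "f \<in> carrier (cohomology G \<alpha>)"
  shows "f \<in> extensional (pverts G)"
    and "(p,q) \<in> parcs G \<Longrightarrow> sym_of (\<alpha> (p,q)) dvd f q - f p"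
  using assms by (auto simp: cohomology_def PiE_def)

lemma dvd_mult_diff:
  fixes a :: "'a::comm_ring_1"
  assumes "a dvd f' - f" "a dvd g' - g"
  shows "a dvd f' * g' - f * g"
proof -
  have "f' * g' - f * g = (f' - f) * g' + f * (g' - g)" by (simp add: algebra_simps)
  with assms show ?thesis by simp
qed

lemma cohomology_algebra:
  assumes "pair_wf_digraph G"
  shows "algebra (ring_of_type_algebra :: 't sym_alg ring)
           (cohomology G (\<alpha> :: 'v \<times> 'v \<Rightarrow> 't::real_vector))"
proof -
  interpret pair_wf_digraph G by fact
  let ?H = "cohomology G \<alpha>"
  note wf = in_arcsD1 in_arcsD2
  have ext: "f = g" if "f \<in> carrier ?H" "g \<in> carrier ?H" "\<And>p. p \<in> pverts G \<Longrightarrow> f p = g p" for f g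
    using that by (meson cohomology_carrierD(1) extensionalityI)
  have ops:
    "f \<otimes>\<^bsub>?H\<^esub> g = (\<lambda>p\<in>pverts G. f p * g p)" "\<one>\<^bsub>?H\<^esub> = (\<lambda>p\<in>pverts G. 1)"
    "\<zero>\<^bsub>?H\<^esub> = (\<lambda>p\<in>pverts G. 0)" "f \<oplus>\<^bsub>?H\<^esub> g = (\<lambda>p\<in>pverts G. f p + g p)"
    "module.smult ?H s f = (\<lambda>p\<in>pverts G. s * f p)" for f g s
    by (simp_all add: cohomology_def)
  have add_cl: "f \<oplus>\<^bsub>?H\<^esub> g \<in> carrier ?H" if "f \<in> carrier ?H" "g \<in> carrier ?H" for f g
  proof (rule cohomology_carrierI)
    fix p q assume e: "(p,q) \<in> parcs G"
    have "sym_of (\<alpha> (p,q)) dvd (f q - f p) + (g q - g p)"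
      using cohomology_carrierD(2)[OF that(1) e] cohomology_carrierD(2)[OF that(2) e]
      by (rule dvd_add)
    then show "sym_of (\<alpha> (p,q)) dvd (f \<oplus>\<^bsub>?H\<^esub> g) q - (f \<oplus>\<^bsub>?H\<^esub> g) p"
      using wf[OF e] by (simp add: ops algebra_simps)
  qed (simp add: ops)
  have mult_cl: "f \<otimes>\<^bsub>?H\<^esub> g \<in> carrier ?H" if "f \<in> carrier ?H" "g \<in> carrier ?H" for f g
    using cohomology_carrierD[OF that(1)] cohomology_carrierD[OF that(2)] wf
    by (intro cohomology_carrierI) (simp_all add: ops dvd_mult_diff)
  have zero_cl: "\<zero>\<^bsub>?H\<^esub> \<in> carrier ?H" and one_cl: "\<one>\<^bsub>?H\<^esub> \<in> carrier ?H"
    using wf by (auto intro!: cohomology_carrierI simp: ops)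
  have smult_cl: "module.smult ?H s f \<in> carrier ?H" if "f \<in> carrier ?H" for s f
    using cohomology_carrierD[OF that] wf
    by (intro cohomology_carrierI) (simp_all add: ops flip: right_diff_distrib)
  have neg: "\<exists>g\<in>carrier ?H. g \<oplus>\<^bsub>?H\<^esub> f = \<zero>\<^bsub>?H\<^esub>" if "f \<in> carrier ?H" for f
  proof
    show "module.smult ?H (-1) f \<in> carrier ?H" using that by (rule smult_cl)
    then show "module.smult ?H (-1) f \<oplus>\<^bsub>?H\<^esub> f = \<zero>\<^bsub>?H\<^esub>"
      using that by (intro ext add_cl zero_cl) (simp_all add: ops)
  qed
  have cring: "cring ?H"
  proof (rule cringI)
    show "abelian_group ?H"
      by (rule abelian_groupI)
         (blast intro: add_cl zero_cl neg | rule ext, simp_all add: add_cl zero_cl, simp add: ops algebra_simps)+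
    show "comm_monoid ?H"
      by (rule comm_monoidI)
         (blast intro: mult_cl one_cl | rule ext, simp_all add: mult_cl one_cl, simp add: ops algebra_simps)+
    show "(f \<oplus>\<^bsub>?H\<^esub> g) \<otimes>\<^bsub>?H\<^esub> h = f \<otimes>\<^bsub>?H\<^esub> h \<oplus>\<^bsub>?H\<^esub> g \<otimes>\<^bsub>?H\<^esub> h"
      if "f \<in> carrier ?H" "g \<in> carrier ?H" "h \<in> carrier ?H" for f g h
      using that by (intro ext add_cl mult_cl) (simp_all add: ops algebra_simps)
  qed
  show ?thesis
  proof (rule algebraI)
    show "cring (ring_of_type_algebra :: 't sym_alg ring)" by (rule cring_from_type_algebra)
  qed (blast intro: cring smult_cl |
       (rule ext, (blast intro: add_cl mult_cl smult_cl)+,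
        simp add: ops ring_of_type_algebra_def algebra_simps))+
qed

lemma pullback_closed:
  assumes "gkm_fiber_bundle G \<alpha> B \<alpha>B \<pi>" "\<beta> \<in> carrier (cohomology B \<alpha>B)"
  shows "pullback G \<pi> \<beta> \<in> carrier (cohomology G \<alpha>)"
proof (rule cohomology_carrierI)
  fix p q assume e: "(p,q) \<in> parcs G"
  obtain nabla nablaB where fib: "gkm_fibration G \<alpha> nabla B \<alpha>B nablaB \<pi>"
    using assms(1) by (auto simp: gkm_fiber_bundle_def)
  then interpret pair_bidirected_digraph G
    by (simp add: gkm_fibration_def gkm_graph_def regular_graph_def)
  have "\<pi> p = \<pi> q \<or> (\<pi> p, \<pi> q) \<in> parcs B"
    using fib e by (auto simp: gkm_fibration_def graph_fibration_def graph_morphism_def)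
  then have "sym_of (\<alpha> (p,q)) dvd \<beta> (\<pi> q) - \<beta> (\<pi> p)"
  proof
    assume b: "(\<pi> p, \<pi> q) \<in> parcs B"
    then have "\<alpha> (p,q) = \<alpha>B (\<pi> p, \<pi> q)"
      using fib e by (auto simp: gkm_fibration_def lifts_def)
    with b show ?thesis using cohomology_carrierD(2)[OF assms(2)] by simp
  qed simp
  then show "sym_of (\<alpha> (p,q)) dvd pullback G \<pi> \<beta> q - pullback G \<pi> \<beta> p"
    using in_arcsD1[OF e] in_arcsD2[OF e] by (simp add: pullback_def)
qed (simp add: pullback_def)

lemma cohomology_over_base_module:
  assumes "gkm_fiber_bundle G \<alpha> B \<alpha>B \<pi>"
  shows "Module.module (cohomology B \<alpha>B) (cohomology_over_base G \<alpha> \<pi>)"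
proof -
  obtain nabla nablaB where fib: "gkm_fibration G \<alpha> nabla B \<alpha>B nablaB \<pi>"
    using assms by (auto simp: gkm_fiber_bundle_def)
  then interpret G: pair_bidirected_digraph G
    by (simp add: gkm_fibration_def gkm_graph_def regular_graph_def)
  from fib interpret B: pair_bidirected_digraph B
    by (simp add: gkm_fibration_def gkm_graph_def regular_graph_def)
  have \<pi>: "\<pi> p \<in> pverts B" if "p \<in> pverts G" for p
    using fib that by (auto simp: gkm_fibration_def graph_fibration_def graph_morphism_def)
  interpret M: cring "cohomology G \<alpha>"
    by (rule algebra.M_cring[OF cohomology_algebra]) unfold_locales
  have HB: "cring (cohomology B \<alpha>B)"
    by (rule algebra.M_cring[OF cohomology_algebra]) unfold_locales
  note pb = pullback_closed[OF assms]
  have hom: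
    "pullback G \<pi> (a \<oplus>\<^bsub>cohomology B \<alpha>B\<^esub> b) = pullback G \<pi> a \<oplus>\<^bsub>cohomology G \<alpha>\<^esub> pullback G \<pi> b"
    "pullback G \<pi> (a \<otimes>\<^bsub>cohomology B \<alpha>B\<^esub> b) = pullback G \<pi> a \<otimes>\<^bsub>cohomology G \<alpha>\<^esub> pullback G \<pi> b"
    "pullback G \<pi> \<one>\<^bsub>cohomology B \<alpha>B\<^esub> = \<one>\<^bsub>cohomology G \<alpha>\<^esub>" for a b
    using \<pi> by (auto simp: pullback_def cohomology_def fun_eq_iff)
  show ?thesis
  proof (rule moduleI)
    show "cring (cohomology B \<alpha>B)" by (rule HB)
    show "abelian_group (cohomology_over_base G \<alpha> \<pi>)"
      by (rule abelian_groupI)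
         (auto simp: cohomology_over_base_def M.a_ac intro: M.l_neg M.a_inv_closed)
  qed (auto simp: cohomology_over_base_def pb hom M.l_distr M.r_distr M.m_assoc)
qed

end

theory Submission
  imports Defs "HOL-Computational_Algebra.Polynomial"
begin

text \<open>
  On each fiber, a class \<open>x\<close> is a unique combination \<open>\<Sum>\<^sub>k b\<^sub>k(p) c\<^sub>k\<close>; this gives uniqueness, and what
  remains is that \<open>a = \<alpha>\<^sub>B(p,q)\<close> divides \<open>b\<^sub>k(q) - b\<^sub>k(p)\<close>. Comparing \<open>x\<close> at the two ends of each lift
  of \<open>(p,q)\<close> shows that \<open>h = \<Sum>\<^sub>k (b\<^sub>k(q) - b\<^sub>k(p)) c\<^sub>k\<close> is divisible by \<open>a\<close> at every vertex of the
  fiber over \<open>p\<close>. Along a vertical edge the axial function is linearly independent of \<open>a\<close>, hence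
  coprime to it in the symmetric algebra, so \<open>h / a\<close> is again a class on the fiber. Expanding it in
  the basis \<open>c\<^sub>k\<close> and comparing coefficients exhibits \<open>b\<^sub>k(q) - b\<^sub>k(p)\<close> as a multiple of \<open>a\<close>.
\<close>

section \<open>Divisibility by linear forms in the symmetric algebra\<close>

definition free_monom_eval :: "('v \<Rightarrow> 'a::comm_ring_1) \<Rightarrow> ('v \<Rightarrow>\<^sub>0 nat) \<Rightarrow> 'a" where
  "free_monom_eval f a = (\<Prod>i\<in>Poly_Mapping.keys a. f i ^ Poly_Mapping.lookup a i)"

definition free_eval ::
  "(real \<Rightarrow> 'a::comm_ring_1) \<Rightarrow> ('v \<Rightarrow> 'a) \<Rightarrow> (('v \<Rightarrow>\<^sub>0 nat) \<Rightarrow>\<^sub>0 real) \<Rightarrow> 'a" where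
  "free_eval \<kappa> f F =
     (\<Sum>a\<in>Poly_Mapping.keys F. \<kappa> (Poly_Mapping.lookup F a) * free_monom_eval f a)"

lemma free_monom_eval_add: "free_monom_eval f (a + b) = free_monom_eval f a * free_monom_eval f b"
proof -
  let ?K = "Poly_Mapping.keys a \<union> Poly_Mapping.keys b"
  have *: "free_monom_eval f c = (\<Prod>i\<in>?K. f i ^ Poly_Mapping.lookup c i)"
    if "Poly_Mapping.keys c \<subseteq> ?K" for c
    unfolding free_monom_eval_def using that
    by (intro prod.mono_neutral_left) (auto simp: in_keys_iff)
  show ?thesis
    using Poly_Mapping.keys_add[of a b] by (simp add: * lookup_add power_add prod.distrib)
qed

text \<open>Serves on two levels: polynomials are sums of single terms, and exponent functions are
  sums of exponents of single variables.\<close>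

lemma poly_mapping_add_single_induct [case_names zero single add]:
  fixes F :: "'a \<Rightarrow>\<^sub>0 'b::comm_monoid_add"
  assumes "P 0" "\<And>a r. P (Poly_Mapping.single a r)" "\<And>F G. P F \<Longrightarrow> P G \<Longrightarrow> P (F + G)"
  shows "P F"
proof -
  have F: "F = (\<Sum>a\<in>Poly_Mapping.keys F. Poly_Mapping.single a (Poly_Mapping.lookup F a))"
    by (rule poly_mapping_eqI)
       (auto simp: lookup_sum lookup_single when_def in_keys_iff)
  have "P (\<Sum>a\<in>A. Poly_Mapping.single a (Poly_Mapping.lookup F a))" if "finite A" for A
    using that by (induction) (auto intro: assms)
  then show ?thesis by (subst F) simp
qed

text \<open>\<open>\<kappa>\<close> is the structure map that makes \<open>'a\<close> a real
  algebra. As an explicit map it allows polynomials over the symmetric algebra as target, with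
  constants \<open>[:sym_const r:]\<close>.\<close>

locale real_ring_hom =
  fixes \<kappa> :: "real \<Rightarrow> 'a::comm_ring_1"
  assumes hom_add: "\<kappa> (r + s) = \<kappa> r + \<kappa> s"
    and hom_mult: "\<kappa> (r * s) = \<kappa> r * \<kappa> s"
    and hom_one: "\<kappa> 1 = 1"
begin

lemma hom_zero: "\<kappa> 0 = 0"
  using hom_add[of 0 0] by simp

lemma free_eval_single: "free_eval \<kappa> f (Poly_Mapping.single a r) = \<kappa> r * free_monom_eval f a"
  by (simp add: free_eval_def hom_zero)

lemma free_eval_zero: "free_eval \<kappa> f 0 = 0"
  by (simp add: free_eval_def)

lemma free_eval_add: "free_eval \<kappa> f (F + G) = free_eval \<kappa> f F + free_eval \<kappa> f G"
proof -
  let ?K = "Poly_Mapping.keys F \<union> Poly_Mapping.keys G"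
  have *: "free_eval \<kappa> f H = (\<Sum>a\<in>?K. \<kappa> (Poly_Mapping.lookup H a) * free_monom_eval f a)"
    if "Poly_Mapping.keys H \<subseteq> ?K" for H
    unfolding free_eval_def using that
    by (intro sum.mono_neutral_left) (auto simp: in_keys_iff hom_zero)
  show ?thesis
    using Poly_Mapping.keys_add[of F G]
    by (simp add: * lookup_add hom_add distrib_right sum.distrib)
qed

lemma free_eval_diff: "free_eval \<kappa> f (F - G) = free_eval \<kappa> f F - free_eval \<kappa> f G"
  using free_eval_add[of f "F - G" G] by simp

text \<open>Both sides are biadditive, so single terms suffice; there, multiplying monomials adds
  their exponents.\<close>

lemma free_eval_mult: "free_eval \<kappa> f (F * G) = free_eval \<kappa> f F * free_eval \<kappa> f G"
proof (induction F rule: poly_mapping_add_single_induct)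
  case (single a r)
  show ?case
  proof (induction G rule: poly_mapping_add_single_induct)
    case (single b s)
    then show ?case
      by (simp add: mult_single free_eval_single free_monom_eval_add hom_mult mult_ac)
  qed (simp_all add: free_eval_zero free_eval_add distrib_left)
qed (simp_all add: free_eval_zero free_eval_add distrib_right)

lemma free_eval_var: "free_eval \<kappa> f (free_var v) = f v"
  by (simp add: free_var_def free_eval_single hom_one free_monom_eval_def)

lemma free_eval_const: "free_eval \<kappa> f (free_const r) = \<kappa> r"
  by (simp add: free_const_def free_eval_single free_monom_eval_def)

text \<open>Linearity of \<open>f\<close> over \<open>\<kappa>\<close> kills both families of
  generators, and the kernel of the evaluation is an ideal. Hence the evaluation descends to the
  quotient.\<close>

lemma free_eval_sym_ideal:
  assumes add: "\<And>u v. f (u + v) = f u + f v" and scale: "\<And>r v. f (r *\<^sub>R v) = \<kappa> r * f v"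
    and "F \<in> sym_ideal"
  shows "free_eval \<kappa> f F = 0"
  using assms(3)
  by (induction rule: sym_ideal.induct)
     (simp_all add: free_eval_zero free_eval_add free_eval_diff free_eval_mult free_eval_var
        free_eval_const add scale)

text \<open>Existence half of the universal property: \<open>E\<close> evaluates a representative,
  and two representatives differ by an element of \<open>sym_ideal\<close>, on which the evaluation
  vanishes.\<close>

lemma sym_alg_universal:
  fixes f :: "'v::real_vector \<Rightarrow> 'a"
  assumes add: "\<And>u v. f (u + v) = f u + f v" and scale: "\<And>r v. f (r *\<^sub>R v) = \<kappa> r * f v"
  obtains E :: "'v sym_alg \<Rightarrow> 'a"
  where "\<And>x y. E (x + y) = E x + E y" "\<And>x y. E (x * y) = E x * E y"
    "\<And>r. E (sym_const r) = \<kappa> r" "\<And>v. E (sym_of v) = f v"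
proof
  define E where "E x = free_eval \<kappa> f (rep_sym_alg x)" for x
  have E: "E (abs_sym_alg F) = free_eval \<kappa> f F" for F
  proof -
    have "sym_rel (rep_sym_alg (abs_sym_alg F)) F"
      by (rule Quotient3_rep_abs[OF Quotient3_sym_alg]) (simp add: sym_rel_def sym_ideal.zero)
    then have "free_eval \<kappa> f (rep_sym_alg (abs_sym_alg F) - F) = 0"
      unfolding sym_rel_def by (rule free_eval_sym_ideal[OF add scale])
    then show ?thesis by (simp add: free_eval_diff E_def)
  qed
  show "E (x + y) = E x + E y" for x y
    by (induction x, induction y) (simp add: plus_sym_alg.abs_eq E free_eval_add)
  show "E (x * y) = E x * E y" for x y
    by (induction x, induction y) (simp add: times_sym_alg.abs_eq E free_eval_mult)
  show "E (sym_const r) = \<kappa> r" for r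
    by (simp add: sym_const.abs_eq E free_eval_const)
  show "E (sym_of v) = f v" for v
    by (simp add: sym_of.abs_eq E free_eval_var)
qed

end

section \<open>Ring generators, translations, and cancellation of coprime linear forms\<close>

lemma sym_const_add: "sym_const (r + s) = sym_const r + sym_const s"
  by transfer (simp add: free_const_def single_add sym_rel_def sym_ideal.zero)

lemma sym_const_mult: "sym_const (r * s) = sym_const r * sym_const s"
  by transfer (simp add: free_const_def mult_single sym_rel_def sym_ideal.zero)

lemma sym_const_one: "sym_const 1 = 1"
  by transfer (simp add: free_const_def sym_rel_def sym_ideal.zero)

lemma sym_const_zero: "sym_const 0 = 0"
  by transfer (simp add: free_const_def sym_rel_def sym_ideal.zero)

text \<open>Constants and vectors generate the symmetric algebra as a ring. The proof builds up
  powers of one variable, then monomials, then polynomials.\<close>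

lemma sym_alg_induct [case_names const gen add mult]:
  assumes const: "\<And>r. P (sym_const r)" and gen: "\<And>v. P (sym_of v)"
    and add: "\<And>x y. P x \<Longrightarrow> P y \<Longrightarrow> P (x + y)" and mult: "\<And>x y. P x \<Longrightarrow> P y \<Longrightarrow> P (x * y)"
  shows "P x"
proof (induction x)
  case (1 F)
  have var: "P (abs_sym_alg (Poly_Mapping.single (Poly_Mapping.single v n) 1))" for v n
  proof (induction n)
    case 0
    then show ?case using const[of 1] by (simp add: sym_const.abs_eq free_const_def)
  next
    case (Suc n)
    have "Poly_Mapping.single (Poly_Mapping.single v (Suc n)) (1::real)
        = free_var v * Poly_Mapping.single (Poly_Mapping.single v n) 1"
      by (simp add: free_var_def mult_single flip: single_add)
    then show ?case
      using mult[OF gen Suc] by (simp add: sym_of.abs_eq times_sym_alg.abs_eq)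
  qed
  have mon: "P (abs_sym_alg (Poly_Mapping.single a 1))" for a
  proof (induction a rule: poly_mapping_add_single_induct)
    case zero
    then show ?case using const[of 1] by (simp add: sym_const.abs_eq free_const_def)
  next
    case (add a b)
    from mult[OF this] show ?case by (simp add: times_sym_alg.abs_eq mult_single)
  qed (rule var)
  show ?case
  proof (induction F rule: poly_mapping_add_single_induct)
    case zero
    then show ?case using const[of 0] by (simp add: sym_const.abs_eq free_const_def)
  next
    case (single a r)
    show ?case
      using mult[OF const[of r] mon[of a]]
      by (simp add: sym_const.abs_eq free_const_def times_sym_alg.abs_eq mult_single)
  next
    case (add F G)
    from assms(3)[OF this] show ?case by (simp add: plus_sym_alg.abs_eq)
  qed
qed

text \<open>The translation \<open>v \<mapsto> v + \<xi>(v) t\<close>, a homomorphism into polynomials in one variable \<open>t\<close>.\<close>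

lemma sym_alg_taylor:
  fixes \<xi> :: "'v::real_vector \<Rightarrow> real"
  assumes "linear \<xi>"
  obtains E :: "'v sym_alg \<Rightarrow> 'v sym_alg poly"
  where "\<And>x y. E (x * y) = E x * E y"
    "\<And>v. E (sym_of v) = [:sym_of v, sym_const (\<xi> v):]" "\<And>x. poly (E x) 0 = x"
proof -
  interpret real_ring_hom "\<lambda>r. [:sym_const r:] :: 'v sym_alg poly"
    by unfold_locales (simp_all add: sym_const_add sym_const_mult sym_const_one one_pCons)
  interpret linear \<xi> by fact
  obtain E :: "'v sym_alg \<Rightarrow> 'v sym_alg poly"
  where E: "\<And>x y. E (x + y) = E x + E y" "\<And>x y. E (x * y) = E x * E y"
    "\<And>r. E (sym_const r) = [:sym_const r:]" "\<And>v. E (sym_of v) = [:sym_of v, sym_const (\<xi> v):]"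
    by (rule sym_alg_universal[of "\<lambda>v. [:sym_of v, sym_const (\<xi> v):]"])
       (auto simp: add scale sym_of_add sym_of_scaleR sym_const_add sym_const_mult)
  \<comment> \<open>At \<open>t = 0\<close> the translation is the identity; this need only be
    checked on constants and vectors.\<close>
  moreover have "poly (E x) 0 = x" for x
    by (induction x rule: sym_alg_induct) (simp_all add: E)
  ultimately show thesis using that by blast
qed

text \<open>The top coefficient of the product is the leading coefficient of \<open>p\<close>, so
  zero divisors in the coefficient ring cause no trouble.\<close>

lemma monic_linear_mult_eq_0_iff:
  fixes a :: "'a::comm_ring_1"
  shows "[:a, 1:] * p = 0 \<longleftrightarrow> p = 0"
proof
  assume *: "[:a, 1:] * p = 0"
  have "coeff ([:a, 1:] * p) (Suc (degree p)) = lead_coeff p"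
    by (simp add: coeff_eq_0)
  with * show "p = 0" by simp
qed simp

text \<open>For a functional with \<open>\<xi> v = 1\<close> the translation sends \<open>v\<close>
  to the monic polynomial \<open>v + t\<close>, which is no zero divisor. Thus
  \<open>E x = 0\<close>, and \<open>t = 0\<close> recovers \<open>x\<close>.\<close>

lemma sym_of_mult_eq_0D:
  assumes "v \<noteq> 0" "sym_of v * x = 0"
  shows "x = 0"
proof -
  have "independent {v}" using assms(1) by simp
  from linear_independent_extend[OF this, of "\<lambda>_. 1::real"]
  obtain \<xi> :: "'a \<Rightarrow> real" where \<xi>: "linear \<xi>" "\<xi> v = 1" by auto
  obtain E :: "'a sym_alg \<Rightarrow> 'a sym_alg poly" where E: "\<And>x y. E (x * y) = E x * E y"
    "\<And>v. E (sym_of v) = [:sym_of v, sym_const (\<xi> v):]" "\<And>x. poly (E x) 0 = x"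
    using sym_alg_taylor[OF \<xi>(1)] by blast
  \<comment> \<open>Additivity is not among the properties of \<open>E\<close> obtained here;
    instead \<open>0\<close> is read as the image of the zero vector.\<close>
  have "E 0 = 0"
    using E(2)[of 0] linear_0[OF \<xi>(1)] sym_of_scaleR[of 0 v] by (simp add: sym_const_zero)
  then have "[:sym_of v, 1:] * E x = 0"
    using E(1)[of "sym_of v" x] assms(2) by (simp add: E(2) \<xi>(2) sym_const_one)
  then have "E x = 0" by (simp only: monic_linear_mult_eq_0_iff)
  then show "x = 0" using E(3)[of x] by simp
qed

text \<open>Modulo \<open>v\<close> the form \<open>w\<close> remains a non-zero-divisor. The
  hypothesis \<open>v \<noteq> w\<close> is separate because for equal vectors \<open>{v, w}\<close>
  collapses to a singleton, which may be independent.\<close>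

lemma sym_of_dvd_mult_cancel:
  assumes "independent {v, w}" "v \<noteq> w" "sym_of v dvd sym_of w * x"
  shows "sym_of v dvd x"
proof -
  have "w \<noteq> 0" using assms(1) dependent_zero by blast
  from linear_independent_extend[OF assms(1), of "\<lambda>u. if u = v then 1 else 0::real"]
  obtain \<xi> :: "'a \<Rightarrow> real" where \<xi>: "linear \<xi>" "\<xi> v = 1" "\<xi> w = 0" using assms(2) by auto
  obtain E :: "'a sym_alg \<Rightarrow> 'a sym_alg poly" where E: "\<And>x y. E (x * y) = E x * E y"
    "\<And>v. E (sym_of v) = [:sym_of v, sym_const (\<xi> v):]" "\<And>x. poly (E x) 0 = x"
    using sym_alg_taylor[OF \<xi>(1)] by blast
  \<comment> \<open>\<open>?P\<close> is induced by the linear projection \<open>u \<mapsto> u - \<xi>(u) v\<close>, which kills \<open>v\<close> and fixes \<open>w\<close>.\<close>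
  let ?P = "\<lambda>x. poly (E x) (- sym_of v)"
  obtain y where "sym_of w * x = sym_of v * y" using assms(3) by (elim dvdE)
  then have "?P (sym_of w) * ?P x = ?P (sym_of v) * ?P y"
    by (metis E(1) poly_mult)
  then have "sym_of w * ?P x = 0"
    by (simp add: E(2) \<xi> sym_const_one sym_const_zero)
  then have P0: "?P x = 0" by (rule sym_of_mult_eq_0D[OF \<open>w \<noteq> 0\<close>])
  \<comment> \<open>The constant term of \<open>E x\<close> is \<open>x\<close>, so
    \<open>?P x\<close> differs from \<open>x\<close> by a multiple of \<open>v\<close>; vanishing
    of \<open>?P x\<close> therefore means divisibility by \<open>v\<close>.\<close>
  obtain a q where aq: "E x = pCons a q" by (cases "E x")
  with E(3)[of x] P0 have "x = sym_of v * poly q (- sym_of v)" by simp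
  then show ?thesis by (rule dvdI)
qed

section \<open>Cohomology of fibers\<close>

lemma cohomology_simps:
  "f \<otimes>\<^bsub>cohomology G \<alpha>\<^esub> g = (\<lambda>v\<in>pverts G. f v * g v)"
  "f \<oplus>\<^bsub>cohomology G \<alpha>\<^esub> g = (\<lambda>v\<in>pverts G. f v + g v)"
  "\<zero>\<^bsub>cohomology G \<alpha>\<^esub> = (\<lambda>v\<in>pverts G. 0)"
  "s \<odot>\<^bsub>cohomology G \<alpha>\<^esub> f = (\<lambda>v\<in>pverts G. s * f v)"
  by (simp_all add: cohomology_def)

text \<open>Reduces sums in the cohomology module to values at vertices, where all later comparisons
  take place.\<close>

lemma finsum_cohomology:
  fixes \<alpha> :: "'v \<times> 'v \<Rightarrow> 't::real_vector"
  assumes "pair_wf_digraph G" "finite A" "\<And>k. k \<in> A \<Longrightarrow> g k \<in> carrier (cohomology G \<alpha>)"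
  shows "(\<Oplus>\<^bsub>cohomology G \<alpha>\<^esub>k\<in>A. g k) = (\<lambda>v\<in>pverts G. \<Sum>k\<in>A. g k v)"
proof -
  interpret H: cring "cohomology G \<alpha>"
    by (rule algebra.M_cring[OF cohomology_algebra[OF assms(1)]])
  show ?thesis
    using assms(2,3)
  proof (induction A)
    case empty
    show ?case by (simp add: cohomology_simps)
  next
    case (insert k A)
    have "(\<Oplus>\<^bsub>cohomology G \<alpha>\<^esub>k\<in>insert k A. g k) = g k \<oplus>\<^bsub>cohomology G \<alpha>\<^esub> (\<Oplus>\<^bsub>cohomology G \<alpha>\<^esub>k\<in>A. g k)"
      using insert by (intro H.finsum_insert) auto
    also have "\<dots> = (\<lambda>v\<in>pverts G. \<Sum>k\<in>insert k A. g k v)"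
      using insert by (auto simp: cohomology_simps fun_eq_iff)
    finally show ?case .
  qed
qed

lemma smult_cohomology_closed:
  assumes "pair_wf_digraph G" "f \<in> carrier (cohomology G \<alpha>)"
  shows "s \<odot>\<^bsub>cohomology G \<alpha>\<^esub> f \<in> carrier (cohomology G \<alpha>)"
  using module.smult_closed[OF algebra.axioms(1)[OF cohomology_algebra[OF assms(1)]] _ assms(2)]
  by (simp add: ring_of_type_algebra_def)

lemma finsum_smult_cohomology:
  assumes "pair_wf_digraph G" "finite A" "\<And>k. k \<in> A \<Longrightarrow> g k \<in> carrier (cohomology G \<alpha>)"
  shows "(\<Oplus>\<^bsub>cohomology G \<alpha>\<^esub>k\<in>A. a k \<odot>\<^bsub>cohomology G \<alpha>\<^esub> g k) = (\<lambda>v\<in>pverts G. \<Sum>k\<in>A. a k * g k v)"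
  using assms
  by (subst finsum_cohomology) (auto simp: smult_cohomology_closed, simp add: cohomology_simps cong: restrict_cong)

text \<open>Spanning and linear independence, read vertex by vertex. The carrier of
  \<open>ring_of_type_algebra\<close> is the whole type, so coefficients carry no membership
  condition.\<close>

lemma module_basis_cohomologyD:
  fixes \<alpha> :: "'v \<times> 'v \<Rightarrow> 't::real_vector"
  assumes "pair_wf_digraph F"
    and "module_basis (ring_of_type_algebra :: 't sym_alg ring) (cohomology F \<alpha>) m c"
  shows "x \<in> carrier (cohomology F \<alpha>) \<Longrightarrow> \<exists>a. \<forall>v\<in>pverts F. x v = (\<Sum>k=1..m. a k * c k v)"
    and "(\<And>v. v \<in> pverts F \<Longrightarrow> (\<Sum>k=1..m. a k * c k v) = 0) \<Longrightarrow> k \<in> {1..m} \<Longrightarrow> a k = 0"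
proof -
  have c: "c k \<in> carrier (cohomology F \<alpha>)" if "k \<in> {1..m}" for k
    using assms(2) that by (simp add: module_basis_def)
  have sum: "(\<Oplus>\<^bsub>cohomology F \<alpha>\<^esub>k\<in>{1..m}. a k \<odot>\<^bsub>cohomology F \<alpha>\<^esub> c k)
      = (\<lambda>v\<in>pverts F. \<Sum>k=1..m. a k * c k v)" for a
    by (rule finsum_smult_cohomology[OF assms(1) finite_atLeastAtMost]) (rule c)
  show "\<exists>a. \<forall>v\<in>pverts F. x v = (\<Sum>k=1..m. a k * c k v)" if "x \<in> carrier (cohomology F \<alpha>)"
  proof -
    have "\<forall>x\<in>carrier (cohomology F \<alpha>). \<exists>a\<in>Pi {1..m} (\<lambda>_. carrier (ring_of_type_algebra :: 't sym_alg ring)).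
        x = (\<Oplus>\<^bsub>cohomology F \<alpha>\<^esub>k\<in>{1..m}. a k \<odot>\<^bsub>cohomology F \<alpha>\<^esub> c k)"
      using assms(2) unfolding module_basis_def by (elim conjE)
    from this[rule_format, OF that] obtain a
      where "x = (\<Oplus>\<^bsub>cohomology F \<alpha>\<^esub>k\<in>{1..m}. a k \<odot>\<^bsub>cohomology F \<alpha>\<^esub> c k)" by (elim bexE)
    then have "\<forall>v\<in>pverts F. x v = (\<Sum>k=1..m. a k * c k v)" unfolding sum by simp
    then show ?thesis by blast
  qed
  show "a k = 0"
    if "\<And>v. v \<in> pverts F \<Longrightarrow> (\<Sum>k=1..m. a k * c k v) = 0" "k \<in> {1..m}"
  proof -
    have "(\<Oplus>\<^bsub>cohomology F \<alpha>\<^esub>k\<in>{1..m}. a k \<odot>\<^bsub>cohomology F \<alpha>\<^esub> c k) = (\<lambda>v\<in>pverts F. 0)"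
      unfolding sum using that(1) by (simp cong: restrict_cong)
    then have "(\<Oplus>\<^bsub>cohomology F \<alpha>\<^esub>k\<in>{1..m}. a k \<odot>\<^bsub>cohomology F \<alpha>\<^esub> c k) = \<zero>\<^bsub>cohomology F \<alpha>\<^esub>"
      by (simp add: cohomology_simps)
    moreover have "a \<in> Pi {1..m} (\<lambda>_. carrier (ring_of_type_algebra :: 't sym_alg ring))"
      by (simp add: ring_of_type_algebra_def)
    ultimately have "a k = \<zero>\<^bsub>ring_of_type_algebra\<^esub>"
      using assms(2) that(2) unfolding module_basis_def by blast
    then show ?thesis by (simp add: ring_of_type_algebra_def)
  qed
qed

lemma pair_wf_digraph_fiber:
  assumes "pair_wf_digraph G"
  shows "pair_wf_digraph (fiber G \<pi> p)"
  using pair_wf_digraph.in_arcsD1[OF assms] pair_wf_digraph.in_arcsD2[OF assms]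
  by unfold_locales (auto simp: fiber_def)

lemma restrict_fiber_cohomology:
  assumes "pair_wf_digraph G" "f \<in> carrier (cohomology G \<alpha>)"
  shows "restrict f (pverts (fiber G \<pi> p)) \<in> carrier (cohomology (fiber G \<pi> p) \<alpha>)"
proof (rule cohomology_carrierI)
  fix u v assume e: "(u, v) \<in> parcs (fiber G \<pi> p)"
  note pair_wf_digraph.in_arcsD1[OF pair_wf_digraph_fiber[OF assms(1)] e]
    pair_wf_digraph.in_arcsD2[OF pair_wf_digraph_fiber[OF assms(1)] e]
  moreover have "(u, v) \<in> parcs G" using e by (simp add: fiber_def)
  ultimately show "sym_of (\<alpha> (u, v)) dvd
      restrict f (pverts (fiber G \<pi> p)) v - restrict f (pverts (fiber G \<pi> p)) u"
    using cohomology_carrierD(2)[OF assms(2)] by simp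
qed simp

section \<open>Classes on the total space\<close>

text \<open>Collects what the divisibility argument draws on. The lift \<open>(v, w)\<close> comes
  from surjectivity of horizontal edges onto base edges, and its axial value from the compatibility
  of \<open>\<alpha>\<close> with \<open>\<alpha>B\<close>.\<close>

lemma gkm_fiber_bundleD:
  assumes "gkm_fiber_bundle G \<alpha> B \<alpha>B \<pi>"
  shows "pair_wf_digraph G" "pair_wf_digraph B"
    and "v \<in> pverts G \<Longrightarrow> \<pi> v \<in> pverts B"
    and "(p, q) \<in> parcs B \<Longrightarrow> v \<in> pverts G \<Longrightarrow> \<pi> v = p \<Longrightarrow>
      \<exists>w. (v, w) \<in> parcs G \<and> \<pi> w = q \<and> \<alpha> (v, w) = \<alpha>B (p, q)"
    and "(u, v) \<in> parcs G \<Longrightarrow> (u, w) \<in> parcs G \<Longrightarrow> v \<noteq> w \<Longrightarrow>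
      \<alpha> (u, v) \<noteq> \<alpha> (u, w) \<and> independent {\<alpha> (u, v), \<alpha> (u, w)}"
    and "(p, q) \<in> parcs B \<Longrightarrow> p \<noteq> q"
proof -
  obtain nabla nablaB where fib: "gkm_fibration G \<alpha> nabla B \<alpha>B nablaB \<pi>"
    using assms by (auto simp: gkm_fiber_bundle_def)
  then interpret G: pair_bidirected_digraph G
    by (simp add: gkm_fibration_def gkm_graph_def regular_graph_def)
  from fib interpret B: pair_bidirected_digraph B
    by (simp add: gkm_fibration_def gkm_graph_def regular_graph_def)
  show "pair_wf_digraph G" "pair_wf_digraph B" by unfold_locales
  show "\<pi> v \<in> pverts B" if "v \<in> pverts G"
    using fib that by (auto simp: gkm_fibration_def graph_fibration_def graph_morphism_def)
  show "\<exists>w. (v, w) \<in> parcs G \<and> \<pi> w = q \<and> \<alpha> (v, w) = \<alpha>B (p, q)"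
    if "(p, q) \<in> parcs B" "v \<in> pverts G" "\<pi> v = p"
  proof -
    have "(p, q) \<in> out_arcs B (\<pi> v)" using that by (simp add: out_arcs_def)
    moreover have "map_prod \<pi> \<pi> ` {e \<in> out_arcs G v. \<not> vertical \<pi> e} = out_arcs B (\<pi> v)"
      using fib that(2) by (auto simp: gkm_fibration_def graph_fibration_def bij_betw_def)
    ultimately obtain e where "e \<in> out_arcs G v" "map_prod \<pi> \<pi> e = (p, q)"
      by (metis (no_types, lifting) imageE mem_Collect_eq)
    then obtain w where w: "(v, w) \<in> parcs G" "\<pi> w = q"
      by (cases e) (auto simp: out_arcs_def)
    then have "(v, w) \<in> lifts G \<pi> (p, q)" using that by (simp add: lifts_def)
    with w that(1) fib show ?thesis unfolding gkm_fibration_def by blast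
  qed
  show "\<alpha> (u, v) \<noteq> \<alpha> (u, w) \<and> independent {\<alpha> (u, v), \<alpha> (u, w)}"
    if "(u, v) \<in> parcs G" "(u, w) \<in> parcs G" "v \<noteq> w"
  proof -
    have "(u, v) \<in> out_arcs G u" "(u, w) \<in> out_arcs G u" "u \<in> pverts G" "(u, v) \<noteq> (u, w)"
      using that G.in_arcsD1[OF that(1)] by (auto simp: out_arcs_def)
    moreover have "\<forall>p\<in>pverts G. \<forall>e\<in>out_arcs G p. \<forall>e'\<in>out_arcs G p. e \<noteq> e' \<longrightarrow>
        \<alpha> e \<noteq> \<alpha> e' \<and> independent {\<alpha> e, \<alpha> e'}"
      using fib unfolding gkm_fibration_def is_axial_function_def by (elim conjE)
    ultimately show ?thesis by blast
  qed
  show "p \<noteq> q" if "(p, q) \<in> parcs B"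
    using B.no_loops[OF that] by simp
qed

text \<open>This is the edge condition that turns coefficients chosen separately over each base
  vertex into classes on the base.\<close>

lemma fiber_coefficients_dvd:
  fixes \<alpha> :: "'v \<times> 'v \<Rightarrow> 't::real_vector"
  assumes gkm: "gkm_fiber_bundle G \<alpha> B \<alpha>B \<pi>"
    and coh: "\<And>k. k \<in> {1..m} \<Longrightarrow> c k \<in> carrier (cohomology G \<alpha>)"
    and basis: "module_basis (ring_of_type_algebra :: 't sym_alg ring) (cohomology (fiber G \<pi> p) \<alpha>) m
        (\<lambda>k. restrict (c k) (pverts (fiber G \<pi> p)))"
    and x: "x \<in> carrier (cohomology G \<alpha>)"
    and x_eq: "\<And>v. v \<in> pverts G \<Longrightarrow> x v = (\<Sum>k=1..m. b k (\<pi> v) * c k v)"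
    and pq: "(p, q) \<in> parcs B" and k: "k \<in> {1..m}"
  shows "sym_of (\<alpha>B (p, q)) dvd b k q - b k p"
proof -
  note bundleD = gkm_fiber_bundleD[OF gkm]
  let ?F = "fiber G \<pi> p" and ?a = "sym_of (\<alpha>B (p, q))"
  \<comment> \<open>At a vertex \<open>v\<close> over \<open>p\<close>, \<open>h v\<close> is the
    error made when \<open>x v\<close> is expanded with the coefficients belonging to
    \<open>q\<close>.\<close>
  define h where "h v = (\<Sum>k=1..m. (b k q - b k p) * c k v)" for v
  note wfG = bundleD(1) and wfF = pair_wf_digraph_fiber[OF bundleD(1), of \<pi> p]
  have F: "v \<in> pverts ?F \<longleftrightarrow> v \<in> pverts G \<and> \<pi> v = p" for v by (simp add: fiber_def)
  have "?a dvd h v" if "v \<in> pverts ?F" for v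
  proof -
    from that F bundleD(4)[OF pq] obtain w
      where w: "(v, w) \<in> parcs G" "\<pi> w = q" "\<alpha> (v, w) = \<alpha>B (p, q)" by blast
    note vw = pair_wf_digraph.in_arcsD1[OF wfG w(1)] pair_wf_digraph.in_arcsD2[OF wfG w(1)]
    \<comment> \<open>Expand \<open>x w\<close> with the coefficients at \<open>q\<close> and
      \<open>x v\<close> with those at \<open>p\<close>. What remains are differences of classes
      along the lift \<open>(v, w)\<close>, whose axial value is
      \<open>\<alpha>B (p, q)\<close>.\<close>
    have "h v = (x w - x v) - (\<Sum>k=1..m. b k q * (c k w - c k v))"
      using that vw w(2) by (simp add: h_def F x_eq algebra_simps sum.distrib sum_subtractf)
    moreover have "?a dvd x w - x v"
      using cohomology_carrierD(2)[OF x w(1)] w(3) by simp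
    moreover have "?a dvd (\<Sum>k=1..m. b k q * (c k w - c k v))"
      using cohomology_carrierD(2)[OF coh w(1)] w(3) by (intro dvd_sum dvd_mult) simp
    ultimately show ?thesis by simp
  qed
  then obtain e where e: "h v = ?a * e v" if "v \<in> pverts ?F" for v
    unfolding dvd_def by metis
  have "restrict e (pverts ?F) \<in> carrier (cohomology ?F \<alpha>)"
  proof (rule cohomology_carrierI)
    fix u v assume uv: "(u, v) \<in> parcs ?F"
    note V = pair_wf_digraph.in_arcsD1[OF wfF uv] pair_wf_digraph.in_arcsD2[OF wfF uv]
    have uvG: "(u, v) \<in> parcs G" using uv by (simp add: fiber_def)
    from V F bundleD(4)[OF pq] obtain w
      where w: "(u, w) \<in> parcs G" "\<pi> w = q" "\<alpha> (u, w) = \<alpha>B (p, q)" by blast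
    \<comment> \<open>\<open>v\<close> lies over \<open>p\<close> and \<open>w\<close> over
      \<open>q\<close>. So a vertical edge and a lift of \<open>(p, q)\<close> are distinct edges at
      \<open>u\<close>, and their axial values are independent.\<close>
    have "v \<noteq> w" using V F w(2) bundleD(6)[OF pq] by auto
    then have indep: "\<alpha> (u, v) \<noteq> \<alpha>B (p, q)" "independent {\<alpha> (u, v), \<alpha>B (p, q)}"
      using bundleD(5)[OF uvG w(1)] w(3) by auto
    \<comment> \<open>The coefficients of \<open>h\<close> are constant on the fiber, so
      \<open>h\<close> inherits the edge condition from the \<open>c k\<close>; the factor
      \<open>?a\<close> is then cancelled by independence.\<close>
    have "sym_of (\<alpha> (u, v)) dvd (\<Sum>k=1..m. (b k q - b k p) * (c k v - c k u))"
      using cohomology_carrierD(2)[OF coh uvG] by (intro dvd_sum dvd_mult)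
    also have "\<dots> = h v - h u"
      by (simp add: h_def right_diff_distrib sum_subtractf)
    also have "\<dots> = ?a * (e v - e u)"
      using V by (simp add: e right_diff_distrib)
    finally have "sym_of (\<alpha> (u, v)) dvd e v - e u"
      by (rule sym_of_dvd_mult_cancel[OF indep(2,1)])
    then show "sym_of (\<alpha> (u, v)) dvd restrict e (pverts ?F) v - restrict e (pverts ?F) u"
      using V by simp
  qed simp
  from module_basis_cohomologyD(1)[OF wfF basis this]
  obtain d where d: "e v = (\<Sum>k=1..m. d k * c k v)" if "v \<in> pverts ?F" for v
    by auto
  \<comment> \<open>Two expansions of \<open>h\<close> in the fiber basis, one from its definition
    and one from \<open>h = ?a * e\<close>, must have equal coefficients.\<close>
  have "(\<Sum>k=1..m. (b k q - b k p - ?a * d k) * restrict (c k) (pverts ?F) v) = 0"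
    if "v \<in> pverts ?F" for v
  proof -
    have "(\<Sum>k=1..m. (b k q - b k p - ?a * d k) * c k v) = h v - ?a * (\<Sum>k=1..m. d k * c k v)"
      by (simp add: h_def sum_subtractf sum_distrib_left left_diff_distrib mult.assoc)
    with that e[OF that] d[OF that] show ?thesis by simp
  qed
  from module_basis_cohomologyD(2)[OF wfF basis this k]
  show ?thesis by (metis dvd_triv_left eq_iff_diff_eq_0)
qed

section \<open>Bijectivity and linearity of the expansion map over the cohomology of the
  base\<close>

theorem mainTheorem1:
  fixes G :: "'v pair_pre_digraph" and B :: "'w pair_pre_digraph"
    and \<alpha> :: "'v \<times> 'v \<Rightarrow> 't::real_vector" and \<alpha>B :: "'w \<times> 'w \<Rightarrow> 't"
    and \<pi> :: "'v \<Rightarrow> 'w"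
    and m :: nat and c :: "nat \<Rightarrow> 'v \<Rightarrow> 't sym_alg"
  assumes finite_dim: "\<exists>A. finite A \<and> span A = (UNIV :: 't set)"
    and gkm_bundle: "gkm_fiber_bundle G \<alpha> B \<alpha>B \<pi>"
    and coh: "\<forall>k\<in>{1..m}. c k \<in> carrier (cohomology G \<alpha>)"
    and fiber_basis: "\<forall>p\<in>pverts B.
      module_basis (ring_of_type_algebra :: 't sym_alg ring) (cohomology (fiber G \<pi> p) \<alpha>) m
        (\<lambda>k. restrict (c k) (pverts (fiber G \<pi> p)))"
  shows "(\<lambda>\<beta>. \<Oplus>\<^bsub>cohomology G \<alpha>\<^esub>k\<in>{1..m}. pullback G \<pi> (\<beta> k) \<otimes>\<^bsub>cohomology G \<alpha>\<^esub> c k)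
           \<in> module_iso (cohomology B \<alpha>B) (free_module (cohomology B \<alpha>B) m)
               (cohomology_over_base G \<alpha> \<pi>)
         \<and> (\<forall>x\<in>carrier (cohomology G \<alpha>).
              \<exists>!\<beta>. \<beta> \<in> {1..m} \<rightarrow>\<^sub>E carrier (cohomology B \<alpha>B) \<and>
                x = (\<Oplus>\<^bsub>cohomology G \<alpha>\<^esub>k\<in>{1..m}. pullback G \<pi> (\<beta> k) \<otimes>\<^bsub>cohomology G \<alpha>\<^esub> c k))"
proof
  let ?H = "cohomology G \<alpha>" and ?HB = "cohomology B \<alpha>B"
  let ?\<phi> = "\<lambda>\<beta>. \<Oplus>\<^bsub>?H\<^esub>k\<in>{1..m}. pullback G \<pi> (\<beta> k) \<otimes>\<^bsub>?H\<^esub> c k"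
  let ?X = "{1..m} \<rightarrow>\<^sub>E carrier ?HB"
  note bundleD = gkm_fiber_bundleD[OF gkm_bundle]
  note wfG = bundleD(1) and wfB = bundleD(2)
  interpret H: cring ?H by (rule algebra.M_cring[OF cohomology_algebra[OF wfG]])
  interpret HB: cring ?HB by (rule algebra.M_cring[OF cohomology_algebra[OF wfB]])
  have c: "c k \<in> carrier ?H" if "k \<in> {1..m}" for k using coh that by blast
  have term_closed: "pullback G \<pi> (\<beta> k) \<otimes>\<^bsub>?H\<^esub> c k \<in> carrier ?H"
    if "\<beta> \<in> ?X" "k \<in> {1..m}" for \<beta> k
    using c[OF that(2)] pullback_closed[OF gkm_bundle PiE_mem[OF that]] by (rule H.m_closed[rotated])
  have \<phi>_closed: "?\<phi> \<beta> \<in> carrier ?H" if "\<beta> \<in> ?X" for \<beta>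
    using term_closed[OF that] by (intro H.finsum_closed) auto
  have \<phi>: "?\<phi> \<beta> = (\<lambda>v\<in>pverts G. \<Sum>k=1..m. \<beta> k (\<pi> v) * c k v)" if "\<beta> \<in> ?X" for \<beta>
    using finsum_cohomology[OF wfG finite_atLeastAtMost term_closed[OF that]]
    by (simp add: cohomology_simps pullback_def cong: restrict_cong)
  have inj: "inj_on ?\<phi> ?X"
  proof (rule inj_onI)
    fix \<beta> \<gamma> assume \<beta>: "\<beta> \<in> ?X" and \<gamma>: "\<gamma> \<in> ?X" and eq: "?\<phi> \<beta> = ?\<phi> \<gamma>"
    \<comment> \<open>A pulled back class is constant on each fiber, so linear independence over
      \<open>p\<close> determines its value there.\<close>
    have "\<beta> k p = \<gamma> k p" if k: "k \<in> {1..m}" and p: "p \<in> pverts B" for k p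
    proof -
      have "(\<Sum>k=1..m. (\<beta> k p - \<gamma> k p) * restrict (c k) (pverts (fiber G \<pi> p)) v) = 0"
        if "v \<in> pverts (fiber G \<pi> p)" for v
        using fun_cong[OF eq[unfolded \<phi>[OF \<beta>] \<phi>[OF \<gamma>]], of v] that
        by (simp add: fiber_def left_diff_distrib sum_subtractf)
      from module_basis_cohomologyD(2)[OF pair_wf_digraph_fiber[OF wfG] fiber_basis[rule_format, OF p] this k]
      show ?thesis by simp
    qed
    then have "\<beta> k = \<gamma> k" if "k \<in> {1..m}" for k
      using that cohomology_carrierD(1)[OF PiE_mem[OF \<beta> that]]
        cohomology_carrierD(1)[OF PiE_mem[OF \<gamma> that]]
      by (intro extensionalityI[of _ "pverts B"]) auto
    then show "\<beta> = \<gamma>" by (rule PiE_ext[OF \<beta> \<gamma>])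
  qed
  have surj: "\<exists>\<beta>\<in>?X. x = ?\<phi> \<beta>" if x: "x \<in> carrier ?H" for x
  proof -
    have "\<exists>a. \<forall>v\<in>pverts G. \<pi> v = p \<longrightarrow> x v = (\<Sum>k=1..m. a k * c k v)" if "p \<in> pverts B" for p
      using module_basis_cohomologyD(1)[OF pair_wf_digraph_fiber[OF wfG] fiber_basis[rule_format, OF that]
          restrict_fiber_cohomology[OF wfG x]]
      by (auto simp: fiber_def)
    then obtain a where a: "x v = (\<Sum>k=1..m. a (\<pi> v) k * c k v)" if "v \<in> pverts G" for v
      using bundleD(3) by metis
    \<comment> \<open>Restriction in both arguments matches the representation: families are
      extensional in \<open>k\<close>, base classes in \<open>p\<close>.\<close>
    define \<beta> where "\<beta> = (\<lambda>k\<in>{1..m}. \<lambda>p\<in>pverts B. a p k)"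
    have "\<beta> \<in> ?X"
    proof (rule PiE_I)
      fix k assume k: "k \<in> {1..m}"
      have "sym_of (\<alpha>B (p, q)) dvd \<beta> k q - \<beta> k p" if pq: "(p, q) \<in> parcs B" for p q
      proof -
        note V = pair_wf_digraph.in_arcsD1[OF wfB pq] pair_wf_digraph.in_arcsD2[OF wfB pq]
        \<comment> \<open>The fiber argument is applied over the initial vertex \<open>p\<close> of
          the edge.\<close>
        have "sym_of (\<alpha>B (p, q)) dvd a q k - a p k"
          using fiber_coefficients_dvd[OF gkm_bundle c fiber_basis[rule_format, OF V(1)] x, of "\<lambda>k p. a p k"]
            a pq k by simp
        with V k show ?thesis by (simp add: \<beta>_def)
      qed
      then show "\<beta> k \<in> carrier ?HB"
        using k by (intro cohomology_carrierI) (simp_all add: \<beta>_def)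
    qed (auto simp: \<beta>_def)
    moreover have "x = ?\<phi> \<beta>"
      unfolding \<phi>[OF \<open>\<beta> \<in> ?X\<close>] using cohomology_carrierD(1)[OF x] a bundleD(3)
      by (intro extensionalityI[of _ "pverts G"]) (simp_all add: \<beta>_def)
    ultimately show ?thesis by blast
  qed
  have "bij_betw ?\<phi> ?X (carrier ?H)"
  proof (rule bij_betw_imageI[OF inj], intro subset_antisym subsetI)
    fix x assume "x \<in> carrier ?H"
    with surj show "x \<in> ?\<phi> ` ?X" by (simp only: image_iff)
  next
    fix x assume "x \<in> ?\<phi> ` ?X"
    then show "x \<in> carrier ?H" by (elim imageE) (simp only: \<phi>_closed)
  qed
  \<comment> \<open>Since \<open>\<pi> v\<close> is a vertex of the base, the restricted operations
    on base classes evaluate pointwise at \<open>\<pi> v\<close>; linearity is then checked at each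
    vertex.\<close>
  moreover have "?\<phi> (\<beta> \<oplus>\<^bsub>free_module ?HB m\<^esub> \<gamma>) = ?\<phi> \<beta> \<oplus>\<^bsub>?H\<^esub> ?\<phi> \<gamma>"
    if "\<beta> \<in> ?X" "\<gamma> \<in> ?X" for \<beta> \<gamma>
  proof -
    have "\<beta> \<oplus>\<^bsub>free_module ?HB m\<^esub> \<gamma> \<in> ?X"
      using that by (auto simp: free_module_def)
    then show ?thesis
      using bundleD(3)
      by (simp only: \<phi> that, simp add: free_module_def cohomology_simps distrib_right sum.distrib
          cong: restrict_cong)
  qed
  moreover have "?\<phi> (r \<odot>\<^bsub>free_module ?HB m\<^esub> \<beta>) = pullback G \<pi> r \<otimes>\<^bsub>?H\<^esub> ?\<phi> \<beta>"
    if "r \<in> carrier ?HB" "\<beta> \<in> ?X" for r \<beta>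
  proof -
    have "r \<odot>\<^bsub>free_module ?HB m\<^esub> \<beta> \<in> ?X"
      using that by (auto simp: free_module_def)
    then show ?thesis
      using bundleD(3)
      by (simp only: \<phi> that, simp add: free_module_def cohomology_simps pullback_def sum_distrib_left
          mult.assoc cong: restrict_cong)
  qed
  ultimately show "?\<phi> \<in> module_iso ?HB (free_module ?HB m) (cohomology_over_base G \<alpha> \<pi>)"
    by (simp add: module_iso_def cohomology_over_base_def free_module_def)
  show "\<forall>x\<in>carrier ?H. \<exists>!\<beta>. \<beta> \<in> ?X \<and> x = ?\<phi> \<beta>"
  proof
    fix x assume "x \<in> carrier ?H"
    from surj[OF this] obtain \<beta> where \<beta>: "\<beta> \<in> ?X" "x = ?\<phi> \<beta>" by (elim bexE)
    show "\<exists>!\<beta>. \<beta> \<in> ?X \<and> x = ?\<phi> \<beta>"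
    proof (rule ex1I)
      show "\<beta> \<in> ?X \<and> x = ?\<phi> \<beta>" using \<beta> by (rule conjI)
    next
      fix \<gamma> assume \<gamma>: "\<gamma> \<in> ?X \<and> x = ?\<phi> \<gamma>"
      show "\<gamma> = \<beta>"
        by (rule inj_onD[OF inj trans[OF sym[OF conjunct2[OF \<gamma>]] \<beta>(2)] conjunct1[OF \<gamma>] \<beta>(1)])
    qed
  qed
qed

end
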